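(* Let $X$ be a Noetherian topological space, let $f:X\longrightarrow X$ be a continuous function, let $\{x_{-n}\}_{n\ge 0}$ be a coherent backward orbit of a point $x\in X$, and let $Y\subseteq X$ be a closed set. Then the set $S:=\{n\in\mathbb{N}\colon x_{-n}\in Y\}$ is a union of at most finitely many arithmetic progressions and a set of Banach density zero.
   Context: A topological space is Noetherian if it has no infinite strictly descending chain of closed subsets. A coherent backward orbit of $x$ with respect to $f$ is a sequence $\{x_{-n}\}_{n\ge 0}$ in $X$ with $x_0=x$ and $f(x_{-n-1})=x_{-n}$ for each $n\ge 0$. An arithmetic progression is a set $\{an+b\colon n\in\mathbb{N}\}$ with $a,b\in\mathbb{N}$; the ratio $a$ is allowed to be $0$. For $S\subseteq\mathbb{N}$, the Banach density is $\delta(S):=\limsup_{|I|\to\infty}\frac{|S\cap I|}{|I|}$, the $\limsup$ taken over intervals $I$ of natural numbers; $S$ has Banach density zero if $\delta(S)=0$. *)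

theory Defs
  imports "HOL-Analysis.Analysis"
begin

definition noetherian_space :: "'a topology \<Rightarrow> bool" where
  "noetherian_space X \<longleftrightarrow>
     \<not> (\<exists>C :: nat \<Rightarrow> 'a set. (\<forall>n. closedin X (C n)) \<and> (\<forall>n. C (Suc n) \<subset> C n))"

text \<open>The value \<open>x n\<close> is the term with index \<open>-n\<close> of the backward orbit of \<open>p\<close>.\<close>

definition coherent_backward_orbit ::
    "'a topology \<Rightarrow> ('a \<Rightarrow> 'a) \<Rightarrow> 'a \<Rightarrow> (nat \<Rightarrow> 'a) \<Rightarrow> bool" where
  "coherent_backward_orbit X f p x \<longleftrightarrow>
     (\<forall>n. x n \<in> topspace X) \<and> x 0 = p \<and> (\<forall>n. f (x (Suc n)) = x n)"

text \<open>The ratio \<open>a\<close> may be \<open>0\<close>, so singletons are arithmetic progressions.\<close>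

definition arithmetic_progression :: "nat set \<Rightarrow> bool" where
  "arithmetic_progression A \<longleftrightarrow> (\<exists>a b. A = {a * n + b | n. True})"

text \<open>The filter of finite intervals \<open>I\<close> of natural numbers with \<open>card I\<close> tending to
  infinity; the position of \<open>I\<close> is unconstrained.\<close>

definition long_intervals :: "nat set filter" where
  "long_intervals = inf (filtercomap card at_top) (principal {I. \<exists>a b. I = {a..b}})"

text \<open>The values are extended reals only because \<open>Limsup\<close> is defined on complete lattices.\<close>

definition banach_density :: "nat set \<Rightarrow> ereal" where
  "banach_density S = Limsup long_intervals (\<lambda>I. ereal (real (card (S \<inter> I)) / real (card I)))"

end

theory Submission
  imports Defs "HOL-Number_Theory.Cong"
begin

text \<open>
  Say that \<open>Z\<close> absorbs a residue class if \<open>x n \<in> Z\<close> for all large \<open>n\<close> in that class. A closed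
  set that is minimal among those absorbing some class, say one modulo \<open>N\<close>, lies in every closed
  set absorbing a subclass of that class. Pulling back along iterates of \<open>f\<close> carries this to all
  classes: a closed set absorbing a class modulo a multiple of \<open>N\<close> absorbs the whole class
  modulo \<open>N\<close> around it.

  If the visits to \<open>Y\<close> in a class modulo \<open>N\<close> are not of density zero, then for some \<open>a > 0\<close>
  the visits followed by another one \<open>a\<close> steps later are not either. Hence \<open>Y \<inter> f\<^sup>-\<^sup>a Y\<close> has the
  same property, and by Noetherian induction one may assume that \<open>f\<^sup>a Y \<subseteq> Y\<close>. The set of visits is
  then infinite and closed under subtracting \<open>a\<close>, so \<open>Y\<close> absorbs a class modulo \<open>a\<close>, and
  therefore the class modulo \<open>N\<close>.
\<close>

section \<open>Sets of Banach density zero\<close>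

text \<open>Upper density at most \<open>1 / L\<close> for each positive \<open>L\<close>, with one
  threshold for windows in any position, as Banach density demands; stated in natural numbers to
  avoid limits and division.\<close>

definition density_null :: "nat set \<Rightarrow> bool" where
  "density_null A \<longleftrightarrow> (\<forall>L. \<exists>K. \<forall>m. \<forall>n\<ge>K. L * card (A \<inter> {m..<m+n}) \<le> n)"

lemma density_null_subset:
  assumes "density_null B" and "A \<subseteq> B"
  shows "density_null A"
  unfolding density_null_def
proof
  fix L
  obtain K where K: "\<And>m n. n \<ge> K \<Longrightarrow> L * card (B \<inter> {m..<m+n}) \<le> n"
    using assms(1) unfolding density_null_def by blast
  have "L * card (A \<inter> {m..<m+n}) \<le> n" if "n \<ge> K" for m n
  proof -
    have "card (A \<inter> {m..<m+n}) \<le> card (B \<inter> {m..<m+n})"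
      using assms(2) by (intro card_mono) auto
    then show ?thesis
      using K[OF that, of m] by (meson le_trans mult_le_mono2)
  qed
  then show "\<exists>K. \<forall>m. \<forall>n\<ge>K. L * card (A \<inter> {m..<m+n}) \<le> n"
    by blast
qed

lemma density_null_finite:
  assumes "finite A"
  shows "density_null A"
  unfolding density_null_def
proof
  fix L
  have "L * card (A \<inter> {m..<m+n}) \<le> n" if "n \<ge> L * card A" for m n
  proof -
    have "card (A \<inter> {m..<m+n}) \<le> card A"
      using assms by (intro card_mono) auto
    then show ?thesis
      using that by (meson le_trans mult_le_mono2)
  qed
  then show "\<exists>K. \<forall>m. \<forall>n\<ge>K. L * card (A \<inter> {m..<m+n}) \<le> n"
    by blast
qed

lemma density_null_Un:
  assumes "density_null A" and "density_null B"
  shows "density_null (A \<union> B)"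
  unfolding density_null_def
proof
  fix L
  obtain K1 where K1: "\<And>m n. n \<ge> K1 \<Longrightarrow> 2 * L * card (A \<inter> {m..<m+n}) \<le> n"
    using assms(1) unfolding density_null_def by blast
  obtain K2 where K2: "\<And>m n. n \<ge> K2 \<Longrightarrow> 2 * L * card (B \<inter> {m..<m+n}) \<le> n"
    using assms(2) unfolding density_null_def by blast
  have "L * card ((A \<union> B) \<inter> {m..<m+n}) \<le> n" if "n \<ge> max K1 K2" for m n
  proof -
    have "card ((A \<union> B) \<inter> {m..<m+n}) \<le> card (A \<inter> {m..<m+n}) + card (B \<inter> {m..<m+n})"
      by (metis Int_Un_distrib2 card_Un_le)
    then have "L * card ((A \<union> B) \<inter> {m..<m+n})
        \<le> L * card (A \<inter> {m..<m+n}) + L * card (B \<inter> {m..<m+n})"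
      by (metis distrib_left mult_le_mono2)
    then show ?thesis
      using K1[of n m] K2[of n m] that by simp
  qed
  then show "\<exists>K. \<forall>m. \<forall>n\<ge>K. L * card ((A \<union> B) \<inter> {m..<m+n}) \<le> n"
    by blast
qed

lemma density_null_UN:
  assumes "finite I" and "\<And>i. i \<in> I \<Longrightarrow> density_null (A i)"
  shows "density_null (\<Union>i\<in>I. A i)"
  using assms
proof (induction I)
  case empty
  then show ?case by (simp add: density_null_finite)
next
  case (insert i I)
  then show ?case by (simp add: density_null_Un)
qed

text \<open>Blocks of length \<open>L\<close> starting at the points of \<open>B\<close> are
  disjoint, and those from the window fit into one longer by \<open>L\<close>.\<close>

lemma card_separated_le:
  fixes B :: "nat set"
  assumes sep: "\<And>b a. b \<in> B \<Longrightarrow> 0 < a \<Longrightarrow> a < L \<Longrightarrow> b + a \<notin> B"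
  shows "L * card (B \<inter> {m..<m+n}) \<le> n + L"
proof -
  let ?C = "B \<inter> {m..<m+n}"
  have disj: "{b..<b+L} \<inter> {c..<c+L} = {}" if "b \<in> B" "c \<in> B" "b < c" for b c
  proof -
    have "\<not> c - b < L"
      using sep[of b "c - b"] that by auto
    then show ?thesis by auto
  qed
  have "L * card ?C = (\<Sum>b\<in>?C. card {b..<b+L})"
    by simp
  also have "\<dots> = card (\<Union>b\<in>?C. {b..<b+L})"
    proof (intro card_UN_disjoint [symmetric] ballI impI)
    fix b c
    assume "b \<in> ?C" "c \<in> ?C" "b \<noteq> c"
    then show "{b..<b+L} \<inter> {c..<c+L} = {}"
      using disj[of b c] disj[of c b] by (cases "b < c") auto
  qed auto
  also have "\<dots> \<le> card {m..<m+n+L}"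
    by (intro card_mono) auto
  finally show ?thesis by simp
qed

text \<open>If returns within any bounded time are rare, deleting them leaves a set with large gaps,
  which is sparse.\<close>

lemma density_null_if_shifts_null:
  fixes A :: "nat set"
  assumes null: "\<And>a. a > 0 \<Longrightarrow> density_null (A \<inter> (\<lambda>n. n + a) ` A)"
  shows "density_null A"
  unfolding density_null_def
proof
  fix L
  \<comment> \<open>Gaps of \<open>4 * L\<close> give
    \<open>4 * L * card \<le> n + 4 * L \<le> 2 * n\<close> outside \<open>D\<close>, half of the
    budget \<open>n\<close>; \<open>D\<close> gets the other half.\<close>
  define D where "D = (\<Union>a\<in>{1..<4*L}. A \<inter> (\<lambda>n. n + a) ` A)"
  have "density_null D"
    unfolding D_def by (intro density_null_UN null) auto
  then obtain K where K: "\<And>m n. n \<ge> K \<Longrightarrow> 2 * L * card (D \<inter> {m..<m+n}) \<le> n"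
    unfolding density_null_def by blast
  have sep: "b + a \<notin> A - D" if "b \<in> A - D" "0 < a" "a < 4 * L" for b a
    using that unfolding D_def by auto
  have "L * card (A \<inter> {m..<m+n}) \<le> n" if "n \<ge> max K (4*L)" for m n
  proof -
    have "A \<inter> {m..<m+n} \<subseteq> ((A - D) \<inter> {m..<m+n}) \<union> (D \<inter> {m..<m+n})"
      by auto
    then have "card (A \<inter> {m..<m+n})
        \<le> card (((A - D) \<inter> {m..<m+n}) \<union> (D \<inter> {m..<m+n}))"
      by (intro card_mono) auto
    also have "\<dots> \<le> card ((A - D) \<inter> {m..<m+n}) + card (D \<inter> {m..<m+n})"
      by (rule card_Un_le)
    finally have "L * card (A \<inter> {m..<m+n})
        \<le> L * card ((A - D) \<inter> {m..<m+n}) + L * card (D \<inter> {m..<m+n})"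
      by (metis distrib_left mult_le_mono2)
    moreover have "4 * L * card ((A - D) \<inter> {m..<m+n}) \<le> n + 4 * L"
      using sep by (rule card_separated_le)
    ultimately show ?thesis
      using K[of n m] that by simp
  qed
  then show "\<exists>K. \<forall>m. \<forall>n\<ge>K. L * card (A \<inter> {m..<m+n}) \<le> n"
    by blast
qed

section \<open>From counting in windows to the Banach density\<close>

lemma long_intervals_neq_bot: "long_intervals \<noteq> bot"
proof
  assume "long_intervals = bot"
  then have "eventually (\<lambda>_. False) long_intervals"
    by simp
  then obtain K :: nat where "\<And>I. K \<le> card I \<Longrightarrow> \<not> (\<exists>a b. I = {a..b::nat})"
    unfolding long_intervals_def eventually_inf_principal eventually_filtercomap
      eventually_at_top_linorder by auto
  from this[of "{0..K}"] show False by auto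
qed

lemma banach_density_eq_0:
  assumes "density_null A"
  shows "banach_density A = 0"
proof -
  have "((\<lambda>I. real (card (A \<inter> I)) / real (card I)) \<longlongrightarrow> 0) long_intervals"
  proof (rule tendstoI)
    fix e :: real
    assume "e > 0"
    then obtain L :: nat where L: "inverse (real (Suc L)) < e"
      using reals_Archimedean by blast
    obtain K where K: "\<And>m n. n \<ge> K \<Longrightarrow> Suc L * card (A \<inter> {m..<m+n}) \<le> n"
      using assms unfolding density_null_def by blast
    \<comment> \<open>\<open>Suc K\<close> instead of \<open>K\<close> keeps the interval nonempty,
      so that its cardinality can be divided by.\<close>
    have small: "dist (real (card (A \<inter> {a..b})) / real (card {a..b})) 0 < e"
      if "card {a..b} \<ge> Suc K" for a b
    proof -
      have eq: "{a..b} = {a..<a + card {a..b}}"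
        using that by auto
      have "Suc L * card (A \<inter> {a..b}) \<le> card {a..b}"
        using K[of "card {a..b}" a] that eq by simp
      then have "real (Suc L) * real (card (A \<inter> {a..b})) \<le> real (card {a..b})"
        by (metis of_nat_le_iff of_nat_mult)
      moreover have "real (card {a..b}) > 0"
        using that by linarith
      ultimately have "real (card (A \<inter> {a..b})) / real (card {a..b}) \<le> inverse (real (Suc L))"
        by (simp add: field_simps)
      then show ?thesis
        using L by simp
    qed
    have "eventually (\<lambda>n. n \<ge> Suc K) at_top"
      by (rule eventually_ge_at_top)
    then have "eventually (\<lambda>I :: nat set. card I \<ge> Suc K) (filtercomap card at_top)"
      by (rule eventually_filtercomapI)
    then show "eventually (\<lambda>I. dist (real (card (A \<inter> I)) / real (card I)) 0 < e) long_intervals"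
      unfolding long_intervals_def eventually_inf_principal
      by eventually_elim (use small in blast)
  qed
  then have "((\<lambda>I. ereal (real (card (A \<inter> I)) / real (card I))) \<longlongrightarrow> ereal 0) long_intervals"
    by (rule tendsto_ereal)
  \<comment> \<open>The filter must be nontrivial: over \<open>bot\<close> the \<open>Limsup\<close>
    would be -infinity.\<close>
  then show ?thesis
    unfolding banach_density_def zero_ereal_def
    by (rule lim_imp_Limsup[OF long_intervals_neq_bot])
qed

section \<open>Residue classes absorbed by closed sets\<close>

lemma wf_closedin_subset:
  fixes X :: "'a topology"
  assumes "noetherian_space X"
  shows "wf {(C, D). closedin X C \<and> closedin X D \<and> C \<subset> D}"
  unfolding wf_iff_no_infinite_down_chain
proof
  assume "\<exists>C. \<forall>n. (C (Suc n), C n) \<in> {(C, D). closedin X C \<and> closedin X D \<and> C \<subset> D}"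
  then obtain C where "\<And>n. (C (Suc n), C n) \<in> {(C, D). closedin X C \<and> closedin X D \<and> C \<subset> D}"
    by blast
  then have "\<forall>n. closedin X (C n)" "\<forall>n. C (Suc n) \<subset> C n"
    by simp_all
  then show False
    using assms unfolding noetherian_space_def by blast
qed

text \<open>For \<open>N = 0\<close> the congruence is equality and every \<open>Z\<close>
  qualifies, hence the positivity conditions on moduli in \<open>ex_stable_modulus\<close>.\<close>

definition absorbs :: "(nat \<Rightarrow> 'a) \<Rightarrow> 'a set \<Rightarrow> nat \<Rightarrow> nat \<Rightarrow> bool" where
  "absorbs x Z c N \<longleftrightarrow> (\<forall>\<^sub>F n in sequentially. [n = c] (mod N) \<longrightarrow> x n \<in> Z)"

lemma absorbs_mono: "absorbs x Z c N \<Longrightarrow> Z \<subseteq> W \<Longrightarrow> absorbs x W c N"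
  unfolding absorbs_def by (erule eventually_mono) auto

lemma absorbs_Int: "absorbs x Z c N \<Longrightarrow> absorbs x W c N \<Longrightarrow> absorbs x (Z \<inter> W) c N"
  unfolding absorbs_def by (erule eventually_elim2, assumption) auto

lemma absorbs_dvd: "absorbs x Z c N \<Longrightarrow> N dvd M \<Longrightarrow> absorbs x Z c M"
  unfolding absorbs_def by (erule eventually_mono) (auto intro: cong_dvd_modulus_nat)

lemma absorbs_cong: "[c = d] (mod N) \<Longrightarrow> absorbs x Z c N \<longleftrightarrow> absorbs x Z d N"
  unfolding absorbs_def cong_def by simp

section \<open>Shifting the index by preimages under iterates\<close>

lemma funpow_backward_orbit:
  assumes "coherent_backward_orbit X f p x"
  shows "(f ^^ j) (x (n + j)) = x n"
proof (induction j)
  case (Suc j)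
  then show ?case
    using assms by (simp add: coherent_backward_orbit_def funpow_swap1)
qed simp

lemma closedin_funpow_preimage:
  assumes "continuous_map X X f" and "closedin X Z"
  shows "closedin X {y \<in> topspace X. (f ^^ j) y \<in> Z}"
proof -
  have "continuous_map X X (f ^^ j)"
  proof (induction j)
    case (Suc j)
    then show ?case
      using assms(1) by (simp only: funpow.simps continuous_map_compose)
  qed (simp only: funpow.simps continuous_map_id)
  then show ?thesis
    using assms(2) by (rule closedin_continuous_map_preimage)
qed

text \<open>\<open>f ^^ j\<close> sends the term of index \<open>n + j\<close> to that of index
  \<open>n\<close>, and the indices below \<open>j\<close> are irrelevant to an eventual
  statement.\<close>

lemma absorbs_funpow_preimage:
  assumes "coherent_backward_orbit X f p x"
  shows "absorbs x {y \<in> topspace X. (f ^^ j) y \<in> Z} (c + j) N \<longleftrightarrow> absorbs x Z c N"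
proof -
  have "x n \<in> topspace X" for n
    using assms by (simp add: coherent_backward_orbit_def)
  then have "absorbs x Z c N \<longleftrightarrow> (\<forall>\<^sub>F n in sequentially.
      [n + j = c + j] (mod N) \<longrightarrow> x (n + j) \<in> {y \<in> topspace X. (f ^^ j) y \<in> Z})"
    unfolding absorbs_def by (simp add: funpow_backward_orbit[OF assms] cong_add_rcancel_nat)
  then show ?thesis
    unfolding absorbs_def
    using eventually_sequentially_seg
      [of "\<lambda>n. [n = c + j] (mod N) \<longrightarrow> x n \<in> {y \<in> topspace X. (f ^^ j) y \<in> Z}" j]
    by simp
qed

text \<open>\<open>N\<close> is the modulus of a minimal absorbing closed set \<open>V\<close>.
  Minimality controls one class only; preimages move every other class onto it, so one
  \<open>N\<close> serves all \<open>Z\<close> and \<open>c\<close>.\<close>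

lemma ex_stable_modulus:
  assumes noeth: "noetherian_space X" and cont: "continuous_map X X f"
    and orbit: "coherent_backward_orbit X f p x"
  obtains N where "N > 0"
    and "\<And>Z c M. closedin X Z \<Longrightarrow> M > 0 \<Longrightarrow> N dvd M \<Longrightarrow> absorbs x Z c M \<Longrightarrow> absorbs x Z c N"
proof -
  let ?Q = "{Z. closedin X Z \<and> (\<exists>c N. N > 0 \<and> absorbs x Z c N)}"
  have "absorbs x (topspace X) 0 1"
    using orbit by (simp add: absorbs_def coherent_backward_orbit_def)
  then have "topspace X \<in> ?Q"
    by force
  then obtain V where V_in: "V \<in> ?Q"
    and V_min: "\<And>Z. (Z, V) \<in> {(C, D). closedin X C \<and> closedin X D \<and> C \<subset> D} \<Longrightarrow> Z \<notin> ?Q"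
    by (rule wfE_min[OF wf_closedin_subset[OF noeth]]) (rule that)
  from V_in obtain r N where V: "closedin X V" "N > 0" "absorbs x V r N"
    by blast
  have min: "\<not> Z \<subset> V" if "Z \<in> ?Q" for Z
    using V_min[of Z] V(1) that by blast
  have "absorbs x Z c N"
    if Z: "closedin X Z" and M: "M > 0" "N dvd M" and abs: "absorbs x Z c M" for Z c M
  proof -
    \<comment> \<open>Chosen so that \<open>c + j = r + N * c\<close>, which lies in the class of
      \<open>r\<close>; the summand \<open>N * c\<close> keeps the subtraction from
      truncating.\<close>
    define j where "j = r + (N * c - c)"
    have "c \<le> N * c"
      using \<open>N > 0\<close> by simp
    then have "c + j = r + N * c"
      unfolding j_def by linarith
    then have cong: "[r = c + j] (mod N)"
      by (simp add: cong_def)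
    define W where "W = {y \<in> topspace X. (f ^^ j) y \<in> Z}"
    have "closedin X W"
      unfolding W_def using cont Z by (rule closedin_funpow_preimage)
    \<comment> \<open>Only the modulus \<open>M\<close> is available here, but \<open>?Q\<close>
      admits any positive modulus, so minimality of \<open>V\<close> still applies.\<close>
    moreover have "absorbs x (V \<inter> W) (c + j) M"
    proof (rule absorbs_Int)
      show "absorbs x V (c + j) M"
        using V(3) M(2) absorbs_cong[OF cong] absorbs_dvd by blast
      show "absorbs x W (c + j) M"
        using abs absorbs_funpow_preimage[OF orbit] by (simp add: W_def)
    qed
    ultimately have "V \<inter> W \<in> ?Q"
      using V(1) M(1) by blast
    then have "V \<subseteq> W"
      using min by blast
    \<comment> \<open>The modulus drops from \<open>M\<close> to \<open>N\<close> here, since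
      \<open>V\<close> absorbs the whole class modulo \<open>N\<close>.\<close>
    then have "absorbs x W (c + j) N"
      using V(3) absorbs_cong[OF cong] absorbs_mono by blast
    then show ?thesis
      using absorbs_funpow_preimage[OF orbit] by (simp add: W_def)
  qed
  then show ?thesis
    using that V(2) by blast
qed

text \<open>By pigeonhole some class modulo \<open>a\<close> meets \<open>T\<close> in arbitrarily
  large elements; descending from them in steps of \<open>a\<close> fills the class.\<close>

lemma ex_residue_class_of_downward_closed:
  fixes T :: "nat set"
  assumes inf: "infinite T" and "a > 0" and down: "\<And>n. n + a \<in> T \<Longrightarrow> n \<in> T"
  obtains c where "c \<in> T" and "\<And>n. [n = c] (mod a) \<Longrightarrow> n \<in> T"
proof -
  have "finite ((\<lambda>n. n mod a) ` T)"
    by (rule finite_subset[of _ "{..<a}"]) (use \<open>a > 0\<close> in auto)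
  then obtain c where c: "c \<in> T" "infinite {n \<in> T. n mod a = c mod a}"
    using pigeonhole_infinite[OF inf] by auto
  have descend: "n \<in> T" if "n + k * a \<in> T" for n k
    using that
  proof (induction k)
    case (Suc k)
    then show ?case
      using down[of "n + k * a"] by (simp add: algebra_simps)
  qed simp
  have "n \<in> T" if "[n = c] (mod a)" for n
  proof -
    obtain m where m: "m \<in> T" "m mod a = c mod a" "n \<le> m"
      using c(2) unfolding infinite_nat_iff_unbounded_le by blast
    then have "a dvd m - n"
      using that by (metis cong_def mod_eq_dvd_iff_nat)
    then obtain k where "m - n = a * k" ..
    then have "m = n + k * a"
      using m(3) by (simp add: mult.commute)
    then show ?thesis
      using descend m(1) by blast
  qed
  then show ?thesis
    using that c(1) by blast
qed

text \<open>As \<open>N\<close> and \<open>r\<close> are fixed before the Noetherian induction,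
  absorption by a smaller closed set passes up to \<open>Y\<close> by monotonicity.\<close>

lemma density_null_or_absorbs:
  assumes noeth: "noetherian_space X" and cont: "continuous_map X X f"
    and orbit: "coherent_backward_orbit X f p x"
    and stable: "\<And>Z c M. closedin X Z \<Longrightarrow> M > 0 \<Longrightarrow> N dvd M \<Longrightarrow> absorbs x Z c M \<Longrightarrow> absorbs x Z c N"
    and closed: "closedin X Y"
  shows "density_null {n. x n \<in> Y \<and> [n = r] (mod N)} \<or> absorbs x Y r N"
  using closed
proof (induction Y rule: wf_induct_rule[OF wf_closedin_subset[OF noeth]])
  case (1 Y)
  define T where "T = {n. x n \<in> Y \<and> [n = r] (mod N)}"
  show ?case
  proof (cases "density_null T")
    case True
    then show ?thesis by (simp add: T_def)
  next
    case False
    then obtain a where a: "a > 0" and nonnull: "\<not> density_null (T \<inter> (\<lambda>n. n + a) ` T)"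
      using density_null_if_shifts_null by blast
    \<comment> \<open>If \<open>n\<close> and \<open>n - a\<close> are both in \<open>T\<close>,
      then \<open>x n\<close> and \<open>(f ^^ a) (x n) = x (n - a)\<close> are in \<open>Y\<close>,
      so \<open>n\<close> is a visit to \<open>W\<close>.\<close>
    define W where "W = Y \<inter> {y \<in> topspace X. (f ^^ a) y \<in> Y}"
    have W: "closedin X W"
      unfolding W_def using closedin_funpow_preimage[OF cont] 1(2) by blast
    have "absorbs x Y r N"
    proof (cases "W = Y")
      case True
      \<comment> \<open>Two elements of one class modulo \<open>N\<close> differ by
        \<open>a\<close>, so \<open>N dvd a\<close>: subtracting \<open>a\<close> preserves the
        class, and \<open>stable\<close> applies with \<open>M = a\<close>.\<close>
      have "T \<inter> (\<lambda>n. n + a) ` T \<noteq> {}"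
        using nonnull density_null_finite by fastforce
      then obtain m where "m \<in> T" "m + a \<in> T"
        by blast
      then have "[m + a = m + 0] (mod N)"
        unfolding T_def by (metis (mono_tags, lifting) add_0_right cong_sym cong_trans mem_Collect_eq)
      then have "N dvd a"
        by (simp only: cong_add_lcancel_nat cong_0_iff)
      have "n \<in> T" if "n + a \<in> T" for n
      proof -
        have "x (n + a) \<in> W"
          using that True by (simp add: T_def)
        then have "x n \<in> Y"
          by (simp add: W_def funpow_backward_orbit[OF orbit])
        moreover have "[n + a = n] (mod N)"
          using \<open>N dvd a\<close> by (auto simp: cong_def)
        ultimately show ?thesis
          using that unfolding T_def by (simp add: cong_def)
      qed
      moreover have "infinite T"
        using False density_null_finite by blast
      ultimately obtain c where c: "c \<in> T" "\<And>n. [n = c] (mod a) \<Longrightarrow> n \<in> T"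
        using ex_residue_class_of_downward_closed a by blast
      then have "absorbs x Y c a"
        unfolding absorbs_def T_def by simp
      \<comment> \<open>Stability enlarges the class modulo \<open>a\<close> to the one modulo
        \<open>N\<close>, which is that of \<open>r\<close> because \<open>c\<close> is in
        \<open>T\<close>.\<close>
      then have "absorbs x Y c N"
        using stable 1(2) a \<open>N dvd a\<close> by blast
      then show ?thesis
        using c(1) absorbs_cong unfolding T_def by blast
    next
      case False
      have "T \<inter> (\<lambda>n. n + a) ` T \<subseteq> {n. x n \<in> W \<and> [n = r] (mod N)}"
        using orbit by (auto simp: T_def W_def funpow_backward_orbit[OF orbit] coherent_backward_orbit_def)
      then have "\<not> density_null {n. x n \<in> W \<and> [n = r] (mod N)}"
        using nonnull density_null_subset by blast
      moreover have "W \<subset> Y"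
        using False by (auto simp: W_def)
      ultimately have "absorbs x W r N"
        using 1 W by blast
      then show ?thesis
        by (rule absorbs_mono) (simp add: W_def)
    qed
    then show ?thesis ..
  qed
qed

lemma absorbs_imp_arithmetic_progression:
  assumes "absorbs x Y r N" and "N > 0"
  obtains A where "arithmetic_progression A"
    and "A \<subseteq> {n. x n \<in> Y}" and "finite ({n. x n \<in> Y \<and> [n = r] (mod N)} - A)"
proof -
  obtain K where K: "\<And>n. n \<ge> K \<Longrightarrow> [n = r] (mod N) \<Longrightarrow> x n \<in> Y"
    using assms(1) unfolding absorbs_def eventually_sequentially by blast
  \<comment> \<open>In the class of \<open>r\<close>, and past the threshold \<open>K\<close>
    because \<open>N\<close> is positive; only indices below \<open>b\<close> can be missed.\<close>
  define b where "b = r + N * K"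
  have b: "b \<ge> K" "[b = r] (mod N)"
    using assms(2) by (auto simp: b_def cong_def trans_le_add2)
  define A where "A = {N * k + b | k. True}"
  have "arithmetic_progression A"
    unfolding arithmetic_progression_def A_def by blast
  moreover have "A \<subseteq> {n. x n \<in> Y}"
    using b by (auto simp: A_def cong_def intro!: K)
  moreover have "n \<in> A" if "n \<ge> b" "[n = r] (mod N)" for n
  proof -
    have "N dvd n - b"
      using that b(2) by (metis cong_def mod_eq_dvd_iff_nat)
    then obtain k where "n - b = N * k" ..
    then have "n = N * k + b"
      using that(1) by simp
    then show ?thesis
      unfolding A_def by blast
  qed
  then have "{n. x n \<in> Y \<and> [n = r] (mod N)} - A \<subseteq> {..<b}"
    by (auto simp: not_le [symmetric])
  then have "finite ({n. x n \<in> Y \<and> [n = r] (mod N)} - A)"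
    using finite_subset by blast
  ultimately show ?thesis
    using that by blast
qed

section \<open>Assembly of the residue classes\<close>

theorem theorem1p7:
  fixes X :: "'a topology" and f :: "'a \<Rightarrow> 'a" and p :: 'a and x :: "nat \<Rightarrow> 'a" and Y :: "'a set"
  assumes "noetherian_space X"
    and "continuous_map X X f"
    and "p \<in> topspace X"
    and "coherent_backward_orbit X f p x"
    and "closedin X Y"
  shows "\<exists>(\<A> :: nat set set) (Z :: nat set).
           finite \<A> \<and> (\<forall>A \<in> \<A>. arithmetic_progression A) \<and>
           banach_density Z = 0 \<and>
           {n. x n \<in> Y} = \<Union>\<A> \<union> Z"
proof -
  obtain N where "N > 0"
    and stable: "\<And>Z c M. closedin X Z \<Longrightarrow> M > 0 \<Longrightarrow> N dvd M \<Longrightarrow> absorbs x Z c M \<Longrightarrow> absorbs x Z c N"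
    using ex_stable_modulus[OF assms(1,2,4)] by blast
  define T where "T r = {n. x n \<in> Y \<and> [n = r] (mod N)}" for r
  \<comment> \<open>Each class needs no progression or a single one. Containment in the visit set
    ensures that the final union does not overshoot.\<close>
  have "\<exists>\<A>. finite \<A> \<and> (\<forall>A\<in>\<A>. arithmetic_progression A \<and> A \<subseteq> {n. x n \<in> Y}) \<and>
      density_null (T r - \<Union>\<A>)" for r
  proof -
    consider "density_null {n. x n \<in> Y \<and> [n = r] (mod N)}" | "absorbs x Y r N"
      using density_null_or_absorbs[OF assms(1,2,4) _ assms(5)] stable by blast
    then show ?thesis
    proof cases
      case 1
      then show ?thesis
        by (intro exI[of _ "{}"]) (simp add: T_def)
    next
      case 2
      then obtain A where "arithmetic_progression A" "A \<subseteq> {n. x n \<in> Y}" "finite (T r - A)"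
        unfolding T_def using \<open>N > 0\<close> by (rule absorbs_imp_arithmetic_progression)
      then show ?thesis
        by (intro exI[of _ "{A}"]) (simp add: density_null_finite)
    qed
  qed
  then obtain \<B> where \<B>: "\<And>r. finite (\<B> r)"
      "\<And>r A. A \<in> \<B> r \<Longrightarrow> arithmetic_progression A \<and> A \<subseteq> {n. x n \<in> Y}"
      "\<And>r. density_null (T r - \<Union>(\<B> r))"
    by metis
  define \<A> where "\<A> = (\<Union>r<N. \<B> r)"
  \<comment> \<open>\<open>Z\<close> collects the null classes and the finite exceptions of the
    others; \<open>n\<close> is treated in the class of \<open>n mod N\<close>.\<close>
  define Z where "Z = {n. x n \<in> Y} - \<Union>\<A>"
  have "n \<in> (\<Union>r<N. T r - \<Union>(\<B> r))" if "n \<in> Z" for n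
  proof -
    have "n \<in> T (n mod N) - \<Union>(\<B> (n mod N))" "n mod N < N"
      using that \<open>N > 0\<close> by (auto simp: Z_def \<A>_def T_def cong_def)
    then show ?thesis
      by blast
  qed
  moreover have "density_null (\<Union>r<N. T r - \<Union>(\<B> r))"
    using \<B>(3) by (intro density_null_UN) auto
  ultimately have "density_null Z"
    using density_null_subset by blast
  then have "banach_density Z = 0"
    by (rule banach_density_eq_0)
  moreover have "finite \<A>" "\<forall>A\<in>\<A>. arithmetic_progression A"
    using \<B> by (auto simp: \<A>_def)
  moreover have "{n. x n \<in> Y} = \<Union>\<A> \<union> Z"
    using \<B>(2) by (auto simp: \<A>_def Z_def)
  ultimately show ?thesis
    by blast
qed

end
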